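(* Let $k \ge 1$ be an integer and let $(X_m)_{m\ge 0}$ be a birth-death chain on the nonnegative integers with right-transition probabilities $(r_n)_{n\ge1}$ and left-transition probabilities $(l_n)_{n\ge1}$, where $r_n+l_n=1$ and $0<r_n<1$ for all $n\ge 1$, with $0$ absorbing and with $X_0=k$ almost surely. Let $(x_n)_{n\ge 0}$, the piecewise linear function $\phi$, and its slopes $(\phi'_n)_{n\ge1}$ be defined from $(r_n),(l_n)$ as in the context. If $\phi'_\infty=\lim_{n\to\infty}\phi'_n$ exists in $[0,+\infty]$ (the values $0$ and $+\infty$ are allowed), then $$\lim_{m\to\infty}E[X_m]=x_k\,\phi'_\infty ,$$ where the right-hand side is $+\infty$ if $\phi'_\infty=+\infty$.
   Context: A birth-death chain with parameters $(r_n)_{n\ge1}$, $(l_n)_{n\ge1}$ is a (time-homogeneous, discrete-time) Markov chain $(X_m)_{m\ge0}$ on $\{0,1,2,\dots\}$ whose transition probabilities are $p_{n,n+1}=r_n$, $p_{n,n-1}=l_n$, and $p_{nj}=0$ if $|n-j|\ne1$, for every $n\ge1$; and $p_{00}=1$ (the state $0$ is absorbing, so $X_m=0$ for all $m$ after the first hitting time of $0$). Set $t_0=1$ and $t_n=\frac{l_1l_2\cdots l_n}{r_1r_2\cdots r_n}$ for $n\ge1$. Define $x_0=0$ and $x_{n+1}=x_n+t_n$ for $n\ge0$, and let $x_\infty=\lim_{n\to\infty} x_n\in(0,+\infty]$. Let $\phi$ be the continuous function on $[0,x_\infty)$ with $\phi(x_n)=n$ for all $n\ge0$ that is linear on each interval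 $(x_{n-1},x_n)$, $n\ge1$. Let $\phi'_n$ denote the constant value of the derivative $\phi'$ on $(x_{n-1},x_n)$; thus $\phi'_n=1/t_{n-1}$. *)

theory Defs
  imports "HOL-Probability.Probability"
begin

text \<open>
  Time-homogeneous Markov chains on a discrete state space. As usual, the conditional
  probability is prescribed only for histories of positive probability.
\<close>

definition markov_chain ::
    "'a measure \<Rightarrow> ('s \<Rightarrow> 's \<Rightarrow> real) \<Rightarrow> (nat \<Rightarrow> 'a \<Rightarrow> 's) \<Rightarrow> bool" where
  "markov_chain M p X \<longleftrightarrow>
     prob_space M \<and>
     (\<forall>m. X m \<in> M \<rightarrow>\<^sub>M count_space UNIV) \<and>
     (\<forall>m s j. \<P>(\<omega> in M. \<forall>i\<le>m. X i \<omega> = s i) > 0 \<longrightarrow>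
        \<P>(\<omega> in M. X (Suc m) \<omega> = j \<bar> \<forall>i\<le>m. X i \<omega> = s i) = p (s m) j)"

text \<open>
  In everything below the parameter sequences are indexed from 1; the values
  \<open>r 0\<close> and \<open>l 0\<close> are never used.
\<close>

definition birth_death_trans ::
    "(nat \<Rightarrow> real) \<Rightarrow> (nat \<Rightarrow> real) \<Rightarrow> nat \<Rightarrow> nat \<Rightarrow> real" where
  "birth_death_trans r l n j =
     (if n = 0 then (if j = 0 then 1 else 0)
      else if j = n + 1 then r n
      else if j = n - 1 then l n
      else 0)"

definition birth_death_chain ::
    "'a measure \<Rightarrow> (nat \<Rightarrow> real) \<Rightarrow> (nat \<Rightarrow> real) \<Rightarrow> (nat \<Rightarrow> 'a \<Rightarrow> nat) \<Rightarrow> bool" where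
  "birth_death_chain M r l X \<longleftrightarrow> markov_chain M (birth_death_trans r l) X"

definition bd_t :: "(nat \<Rightarrow> real) \<Rightarrow> (nat \<Rightarrow> real) \<Rightarrow> nat \<Rightarrow> real" where
  "bd_t r l n = (\<Prod>i=1..n. l i) / (\<Prod>i=1..n. r i)"

primrec bd_x :: "(nat \<Rightarrow> real) \<Rightarrow> (nat \<Rightarrow> real) \<Rightarrow> nat \<Rightarrow> real" where
  "bd_x r l 0 = 0"
| "bd_x r l (Suc n) = bd_x r l n + bd_t r l n"

definition bd_x_inf :: "(nat \<Rightarrow> real) \<Rightarrow> (nat \<Rightarrow> real) \<Rightarrow> ereal" where
  "bd_x_inf r l = lim (\<lambda>n. ereal (bd_x r l n))"

text \<open>
  The interpolating function is a total function on the reals that is constrained only on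
  \<open>[0, x\<^sub>\<infinity>)\<close>, where the conditions determine it.
\<close>

definition bd_phi ::
    "(nat \<Rightarrow> real) \<Rightarrow> (nat \<Rightarrow> real) \<Rightarrow> (real \<Rightarrow> real) \<Rightarrow> bool" where
  "bd_phi r l \<phi> \<longleftrightarrow>
     continuous_on {y. 0 \<le> y \<and> ereal y < bd_x_inf r l} \<phi> \<and>
     (\<forall>n. \<phi> (bd_x r l n) = real n) \<and>
     (\<forall>n\<ge>1. \<exists>a b. \<forall>y\<in>{bd_x r l (n - 1)<..<bd_x r l n}. \<phi> y = a * y + b)"

definition bd_slope ::
    "(nat \<Rightarrow> real) \<Rightarrow> (nat \<Rightarrow> real) \<Rightarrow> (real \<Rightarrow> real) \<Rightarrow> nat \<Rightarrow> real" where
  "bd_slope r l \<phi> n =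
     (THE d. \<forall>y\<in>{bd_x r l (n - 1)<..<bd_x r l n}. (\<phi> has_real_derivative d) (at y))"

lemma bd_t_pos:
  assumes "\<And>n. n \<ge> 1 \<Longrightarrow> 0 < r n" and "\<And>n. n \<ge> 1 \<Longrightarrow> 0 < l n"
  shows "0 < bd_t r l n"
  using assms unfolding bd_t_def by (auto intro!: divide_pos_pos prod_pos)

lemma bd_x_strict_mono:
  assumes "\<And>n. n \<ge> 1 \<Longrightarrow> 0 < r n" and "\<And>n. n \<ge> 1 \<Longrightarrow> 0 < l n"
  shows "strict_mono (bd_x r l)"
  by (rule strict_mono_Suc_iff[THEN iffD2]) (simp add: bd_t_pos[of r l] assms)

lemma bd_x_inf_eq:
  assumes "\<And>n. n \<ge> 1 \<Longrightarrow> 0 < r n" and "\<And>n. n \<ge> 1 \<Longrightarrow> 0 < l n"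
  shows "bd_x_inf r l = (SUP n. ereal (bd_x r l n))"
proof -
  have "incseq (\<lambda>n. ereal (bd_x r l n))"
    using strict_mono_mono[OF bd_x_strict_mono[of r l]] assms by (auto simp: mono_def)
  from LIMSEQ_SUP[OF this] show ?thesis
    unfolding bd_x_inf_def by (rule limI)
qed

text \<open>The interpolating function exists, and its slopes are the reciprocals of the \<open>t\<^sub>n\<close>.\<close>

lemma bd_phi_exists:
  assumes r: "\<And>n. n \<ge> 1 \<Longrightarrow> 0 < r n" and l: "\<And>n. n \<ge> 1 \<Longrightarrow> 0 < l n"
  shows "\<exists>\<phi>. bd_phi r l \<phi>"
proof -
  let ?x = "bd_x r l" and ?t = "bd_t r l"
  define f where "f n y = min 1 (max 0 ((y - ?x n) / ?t n))" for n y
  define \<phi> where "\<phi> y = (\<Sum>n. f n y)" for y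
  have t: "0 < ?t n" for n by (rule bd_t_pos[of r l, OF r l])
  have mono: "?x m \<le> ?x n" if "m \<le> n" for m n
    by (rule monoD[OF strict_mono_mono[OF bd_x_strict_mono[of r l, OF r l]] that])
  have f0: "f n y = 0" if "y \<le> ?x n" for n y
    using that t[of n] by (simp add: f_def divide_nonpos_pos max_absorb1)
  have f1: "f n y = 1" if "?x (Suc n) \<le> y" for n y
    using that t[of n] by (simp add: f_def min_def max_def field_simps)
  have fin: "\<phi> y = (\<Sum>n<N. f n y)" if "y \<le> ?x N" for y N
    unfolding \<phi>_def
  proof (rule suminf_finite)
    fix n assume "n \<notin> {..<N}"
    then have "?x N \<le> ?x n" by (intro mono) simp
    with that show "f n y = 0" by (intro f0) linarith
  qed simp
  have inside: "\<phi> y = (1 / ?t n) * y + (real n - ?x n / ?t n)"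
    if y: "?x n \<le> y" "y \<le> ?x (Suc n)" for n y
  proof -
    have "\<phi> y = (\<Sum>i<n. f i y) + f n y" using fin[OF y(2)] by simp
    also have "(\<Sum>i<n. f i y) = (\<Sum>i<n. 1)"
    proof (rule sum.cong)
      fix i assume "i \<in> {..<n}"
      then have "?x (Suc i) \<le> ?x n" by (intro mono) simp
      with y show "f i y = 1" by (intro f1) linarith
    qed simp
    also have "f n y = (y - ?x n) / ?t n"
      using y t[of n] by (simp add: f_def min_def max_def field_simps)
    finally show ?thesis by (simp add: diff_divide_distrib)
  qed
  have "continuous_on {y. 0 \<le> y \<and> ereal y < bd_x_inf r l} \<phi>"
  proof (rule continuous_at_imp_continuous_on, intro ballI)
    fix y assume "y \<in> {y. 0 \<le> y \<and> ereal y < bd_x_inf r l}"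
    then obtain N where N: "y < ?x N"
      by (auto simp: bd_x_inf_eq[of r l, OF r l] less_SUP_iff)
    have "continuous_on {..<?x N} (\<lambda>y. \<Sum>n<N. f n y)"
      unfolding f_def by (intro continuous_intros) (use t in \<open>metis less_irrefl\<close>)
    then have "continuous_on {..<?x N} \<phi>"
      by (rule continuous_on_cong[THEN iffD1, rotated 2]) (auto simp: fin[of _ N])
    then show "isCont \<phi> y"
      using N by (simp add: continuous_on_eq_continuous_at)
  qed
  moreover have "\<phi> (?x n) = real n" for n
    using inside[of n "?x n"] t[of n] by simp
  moreover have "\<exists>a b. \<forall>y\<in>{?x (n - 1)<..<?x n}. \<phi> y = a * y + b" if "n \<ge> 1" for n
  proof -
    have "\<phi> y = (1 / ?t (n - 1)) * y + (real (n - 1) - ?x (n - 1) / ?t (n - 1))"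
      if "y \<in> {?x (n - 1)<..<?x n}" for y
      by (rule inside) (use that \<open>n \<ge> 1\<close> in simp_all)
    then show ?thesis by (intro exI ballI)
  qed
  ultimately have "bd_phi r l \<phi>" unfolding bd_phi_def by simp
  then show ?thesis by (rule exI[of _ \<phi>])
qed

lemma bd_slope_eq:
  assumes r: "\<And>n. n \<ge> 1 \<Longrightarrow> 0 < r n" and l: "\<And>n. n \<ge> 1 \<Longrightarrow> 0 < l n"
    and phi: "bd_phi r l \<phi>" and n: "n \<ge> 1"
  shows "bd_slope r l \<phi> n = 1 / bd_t r l (n - 1)"
    and "y \<in> {bd_x r l (n - 1)<..<bd_x r l n} \<Longrightarrow>
      (\<phi> has_real_derivative 1 / bd_t r l (n - 1)) (at y)"
proof -
  let ?x = "bd_x r l" and ?t = "bd_t r l (n - 1)"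
  have t: "0 < ?t" by (rule bd_t_pos[of r l, OF r l])
  have xn: "?x n = ?x (n - 1) + ?t" using n by (cases n) auto
  obtain a b where ab: "\<And>y. y \<in> {?x (n - 1)<..<?x n} \<Longrightarrow> \<phi> y = a * y + b"
    using phi n unfolding bd_phi_def by blast
  have "{?x (n - 1)..?x n} \<subseteq> {y. 0 \<le> y \<and> ereal y < bd_x_inf r l}"
  proof -
    have "0 \<le> ?x (n - 1)"
      using strict_mono_mono[OF bd_x_strict_mono[of r l, OF r l], THEN monoD, of 0 "n - 1"] by simp
    moreover have "ereal (?x n) < bd_x_inf r l"
    proof -
      have "ereal (?x n) < ereal (?x (Suc n))" by (simp add: bd_t_pos[of r l, OF r l])
      also have "\<dots> \<le> bd_x_inf r l"
        by (subst bd_x_inf_eq[of r l]) (auto intro: r l intro!: SUP_upper simp del: bd_x.simps)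
      finally show ?thesis .
    qed
    ultimately show ?thesis
    proof (intro subsetI)
      fix z assume z: "z \<in> {?x (n - 1)..?x n}"
      then have "ereal z \<le> ereal (?x n)" by simp
      also note \<open>ereal (?x n) < bd_x_inf r l\<close>
      finally show "z \<in> {y. 0 \<le> y \<and> ereal y < bd_x_inf r l}"
        using z \<open>0 \<le> ?x (n - 1)\<close> by simp
    qed
  qed
  then have cont: "continuous_on {?x (n - 1)..?x n} \<phi>"
    using phi continuous_on_subset unfolding bd_phi_def by blast
  have cl: "closure {?x (n - 1)<..<?x n} = {?x (n - 1)..?x n}"
    using t xn by simp
  have ext: "\<phi> y - (a * y + b) = 0" if y: "y \<in> {?x (n - 1)..?x n}" for y
  proof (rule continuous_constant_on_closure[of "{?x (n - 1)<..<?x n}" "\<lambda>y. \<phi> y - (a * y + b)"])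
    show "continuous_on (closure {?x (n - 1)<..<?x n}) (\<lambda>y. \<phi> y - (a * y + b))"
      unfolding cl by (intro continuous_intros cont)
    show "\<phi> z - (a * z + b) = 0" if "z \<in> {?x (n - 1)<..<?x n}" for z
      using ab[OF that] by simp
    show "y \<in> closure {?x (n - 1)<..<?x n}"
      unfolding cl by (rule y)
  qed
  have phx: "\<phi> (?x m) = real m" for m using phi by (simp add: bd_phi_def)
  have "a * ?x (n - 1) + b = real (n - 1)" "a * ?x n + b = real n"
    using ext[of "?x (n - 1)"] ext[of "?x n"] phx[of n] phx[of "n - 1"] t xn by auto
  then have "a * (?x n - ?x (n - 1)) = 1" using n by (simp add: right_diff_distrib)
  then have "a * ?t = 1" unfolding xn by simp
  then have a: "a = 1 / ?t" using t by (simp add: field_simps)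
  have der: "(\<phi> has_real_derivative 1 / ?t) (at y)" if "y \<in> {?x (n - 1)<..<?x n}" for y
  proof (rule has_field_derivative_transform_within_open[where S = "{?x (n - 1)<..<?x n}"])
    show "((\<lambda>y. a * y + b) has_real_derivative 1 / ?t) (at y)"
      unfolding a[symmetric] by (auto intro!: derivative_eq_intros)
  qed (use that ab in auto)
  then show "y \<in> {?x (n - 1)<..<?x n} \<Longrightarrow> (\<phi> has_real_derivative 1 / ?t) (at y)" .
  have mid: "?x (n - 1) + ?t / 2 \<in> {?x (n - 1)<..<?x n}" using t xn by simp
  show "bd_slope r l \<phi> n = 1 / ?t"
    unfolding bd_slope_def
  proof (rule the_equality)
    show "\<forall>y\<in>{?x (n - 1)<..<?x n}. (\<phi> has_real_derivative 1 / ?t) (at y)"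
      using der by blast
    fix d assume "\<forall>y\<in>{?x (n - 1)<..<?x n}. (\<phi> has_real_derivative d) (at y)"
    with mid have "(\<phi> has_real_derivative d) (at (?x (n - 1) + ?t / 2))" by blast
    then show "d = 1 / ?t" using der[OF mid] by (rule DERIV_unique)
  qed
qed

end

theory Submission
  imports Defs
begin

text \<open>
  The function \<open>bd_x r l\<close> is harmonic for the chain, so the mean of \<open>bd_x r l (X m)\<close> is
  constantly \<open>bd_x r l k\<close>. The probability of absorption by time \<open>m\<close> increases with \<open>m\<close> and
  hence converges, which forces \<open>P(X m = n)\<close> to vanish in the limit for every \<open>n \<ge> 1\<close>. If
  \<open>c < L\<close>, then \<open>n - c * x\<^sub>n\<close>, the sum of the \<open>1 - c * t\<^sub>i\<close> over \<open>i < n\<close>, is eventually nonnegative,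
  and only finitely many states, none of them \<open>0\<close>, can contribute negatively to
  \<open>E[X m] - c * x\<^sub>k = E[X m - c * bd_x r l (X m)]\<close>; so the lower limit of \<open>E[X m] / x\<^sub>k\<close> is at least
  \<open>c\<close>. The case \<open>c > L\<close> is symmetric.
\<close>

section \<open>One-step joint law of a Markov chain on a countable state space\<close>

lemma markov_chain_joint:
  fixes X :: "nat \<Rightarrow> 'a \<Rightarrow> 's::countable"
  assumes "markov_chain M p X"
  shows "measure M {\<omega> \<in> space M. X m \<omega> = i \<and> X (Suc m) \<omega> = j} =
         measure M {\<omega> \<in> space M. X m \<omega> = i} * p i j"
proof -
  interpret prob_space M using assms by (simp add: markov_chain_def)
  have [measurable]: "X m \<in> M \<rightarrow>\<^sub>M count_space UNIV" for m
    using assms by (simp add: markov_chain_def)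
  have [measurable]: "{\<omega> \<in> space M. X m \<omega> = a} \<in> sets M" for m a by measurable
  \<comment> \<open>The Markov property conditions on whole histories. The event
    \<open>X m = i\<close> is therefore cut into countably many disjoint pieces, one for each list
    of states of length m + 1 ending in i.\<close>
  let ?H = "\<lambda>h. {\<omega> \<in> space M. \<forall>i\<le>m. X i \<omega> = h ! i}"
  let ?I = "{h :: 's list. length h = Suc m \<and> h ! m = i}"
  have [measurable]: "?H h \<in> sets M" for h by measurable
  have split: "emeasure M ({\<omega> \<in> space M. X m \<omega> = i} \<inter> A) =
      (\<integral>\<^sup>+h. emeasure M (?H h \<inter> A) \<partial>count_space ?I)" if [measurable]: "A \<in> sets M" for A
  proof -
    have "{\<omega> \<in> space M. X m \<omega> = i} \<inter> A = (\<Union>h\<in>?I. ?H h \<inter> A)"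
    proof (intro equalityI subsetI)
      fix \<omega> assume "\<omega> \<in> {\<omega> \<in> space M. X m \<omega> = i} \<inter> A"
      moreover define h where "h = map (\<lambda>i. X i \<omega>) [0..<Suc m]"
      moreover have "h ! a = X a \<omega>" if "a \<le> m" for a
        unfolding h_def using that by (subst nth_map) (simp_all del: upt_Suc)
      ultimately show "\<omega> \<in> (\<Union>h\<in>?I. ?H h \<inter> A)"
        by (intro UN_I[of h]) (simp_all del: upt_Suc)
    qed auto
    moreover have "disjoint_family_on (\<lambda>h. ?H h \<inter> A) ?I"
    proof (unfold disjoint_family_on_def, intro ballI impI)
      fix g h assume gh: "g \<in> ?I" "h \<in> ?I" "g \<noteq> h"
      then obtain a where "a \<le> m" "g ! a \<noteq> h ! a"
        by (auto simp: list_eq_iff_nth_eq less_Suc_eq_le)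
      then show "?H g \<inter> A \<inter> (?H h \<inter> A) = {}" by force
    qed
    ultimately show ?thesis
      by (simp only:) (rule emeasure_UN_countable; simp)
  qed
  \<comment> \<open>On a null history the conditional probability is not prescribed, but both sides
    are 0.\<close>
  have step: "emeasure M (?H h \<inter> {\<omega> \<in> space M. X (Suc m) \<omega> = j}) = emeasure M (?H h) * ennreal (p i j)"
    if h: "h \<in> ?I" for h
  proof (cases "prob (?H h) > 0")
    case True
    then have "\<P>(\<omega> in M. X (Suc m) \<omega> = j \<bar> \<forall>a\<le>m. X a \<omega> = h ! a) = p (h ! m) j"
      using assms unfolding markov_chain_def by blast
    then have c: "prob {\<omega> \<in> space M. X (Suc m) \<omega> = j \<and> (\<forall>a\<le>m. X a \<omega> = h ! a)} / prob (?H h) = p i j"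
      using h by (simp add: cond_prob_def)
    have "0 \<le> p i j" unfolding c[symmetric] by simp
    have "?H h \<inter> {\<omega> \<in> space M. X (Suc m) \<omega> = j} =
        {\<omega> \<in> space M. X (Suc m) \<omega> = j \<and> (\<forall>a\<le>m. X a \<omega> = h ! a)}" by auto
    then have "prob (?H h \<inter> {\<omega> \<in> space M. X (Suc m) \<omega> = j}) = prob (?H h) * p i j"
      using c True by (simp add: field_simps)
    then show ?thesis using \<open>0 \<le> p i j\<close> by (simp add: emeasure_eq_measure ennreal_mult')
  next
    case False
    then have "prob (?H h) = 0" by (simp add: zero_less_measure_iff)
    then have "emeasure M (?H h) = 0" by (simp add: emeasure_eq_measure)
    moreover have "emeasure M (?H h \<inter> {\<omega> \<in> space M. X (Suc m) \<omega> = j}) \<le> emeasure M (?H h)"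
      by (rule emeasure_mono) auto
    ultimately show ?thesis by simp
  qed
  have "emeasure M ({\<omega> \<in> space M. X m \<omega> = i} \<inter> {\<omega> \<in> space M. X (Suc m) \<omega> = j}) =
      (\<integral>\<^sup>+h. emeasure M (?H h) * ennreal (p i j) \<partial>count_space ?I)"
    by (subst split) (auto intro!: nn_integral_cong step)
  also have "\<dots> = (\<integral>\<^sup>+h. emeasure M (?H h) \<partial>count_space ?I) * ennreal (p i j)"
    by (rule nn_integral_multc) simp
  also have "(\<integral>\<^sup>+h. emeasure M (?H h) \<partial>count_space ?I) =
      (\<integral>\<^sup>+h. emeasure M (?H h \<inter> space M) \<partial>count_space ?I)"
    by (intro nn_integral_cong arg_cong[where f = "emeasure M"]) auto
  also have "\<dots> = emeasure M {\<omega> \<in> space M. X m \<omega> = i}"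
    by (subst split[symmetric]) (auto intro!: arg_cong[where f = "emeasure M"])
  finally have e: "emeasure M ({\<omega> \<in> space M. X m \<omega> = i} \<inter> {\<omega> \<in> space M. X (Suc m) \<omega> = j}) =
      emeasure M {\<omega> \<in> space M. X m \<omega> = i} * ennreal (p i j)" .
  have eq: "{\<omega> \<in> space M. X m \<omega> = i} \<inter> {\<omega> \<in> space M. X (Suc m) \<omega> = j} =
      {\<omega> \<in> space M. X m \<omega> = i \<and> X (Suc m) \<omega> = j}" by auto
  show ?thesis
  proof (cases "prob {\<omega> \<in> space M. X m \<omega> = i} = 0")
    case True
    then show ?thesis using e by (simp add: emeasure_eq_measure eq)
  next
    case False
    \<comment> \<open>Since \<open>p\<close> is any real function and \<open>ennreal\<close>
      truncates negative values to 0, returning to real numbers requires \<open>p i j\<close> to be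
      nonnegative. A history of positive probability ending in i exhibits it as a conditional
      probability.\<close>
    obtain h where "h \<in> ?I" "emeasure M (?H h) \<noteq> 0"
    proof (rule ccontr)
      assume "\<not> thesis"
      then have "(\<integral>\<^sup>+h. emeasure M (?H h \<inter> space M) \<partial>count_space ?I) = 0"
        using that by (subst nn_integral_0_iff_AE) (auto simp: AE_count_space Int_absorb2)
      then show False
        using False by (subst (asm) split[symmetric]) (auto simp: emeasure_eq_measure Int_absorb2)
    qed
    then have "prob (?H h) > 0" by (simp add: emeasure_eq_measure zero_less_measure_iff)
    then have "\<P>(\<omega> in M. X (Suc m) \<omega> = j \<bar> \<forall>a\<le>m. X a \<omega> = h ! a) = p (h ! m) j"
      using assms unfolding markov_chain_def by blast
    then have c: "\<P>(\<omega> in M. X (Suc m) \<omega> = j \<bar> \<forall>a\<le>m. X a \<omega> = h ! a) = p i j"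
      using \<open>h \<in> ?I\<close> by simp
    have "0 \<le> p i j" unfolding c[symmetric] cond_prob_def by simp
    with e show ?thesis by (simp add: emeasure_eq_measure eq flip: ennreal_mult')
  qed
qed

section \<open>Sums of real sequences, and the scale sequence as a sum\<close>

lemma eventually_sum_nonneg:
  fixes u :: "nat \<Rightarrow> real"
  assumes "d > 0" and "\<forall>\<^sub>F i in sequentially. d \<le> u i"
  shows "\<forall>\<^sub>F n in sequentially. 0 \<le> (\<Sum>i<n. u i)"
proof -
  from assms(2) obtain N where N: "\<And>i. i \<ge> N \<Longrightarrow> d \<le> u i"
    by (auto simp: eventually_sequentially)
  let ?S = "\<Sum>i<N. u i"
  \<comment> \<open>K terms of size at least d outweigh the fixed, possibly negative, initial
    sum.\<close>
  obtain K :: nat where K: "- ?S < real K * d"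
    using reals_Archimedean3[OF \<open>d > 0\<close>] by blast
  have "0 \<le> (\<Sum>i<n. u i)" if n: "n \<ge> N + K" for n
  proof -
    have "real K * d \<le> real (card {N..<n}) * d"
      using n \<open>d > 0\<close> by (intro mult_right_mono) auto
    also have "\<dots> \<le> (\<Sum>i=N..<n. u i)" using N by (intro sum_bounded_below) auto
    finally have "0 \<le> ?S + (\<Sum>i=N..<n. u i)" using K by linarith
    also have "\<dots> = (\<Sum>i<n. u i)"
      using n sum.atLeastLessThan_concat[of 0 N n u] by (simp add: atLeast0LessThan)
    finally show ?thesis .
  qed
  then show ?thesis by (auto simp: eventually_sequentially)
qed

lemma bd_x_eq_sum: "bd_x r l n = (\<Sum>i<n. bd_t r l i)"
  by (induction n) auto

lemma bd_t_Suc: "bd_t r l (Suc n) = bd_t r l n * l (Suc n) / r (Suc n)"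
  by (simp add: bd_t_def)

section \<open>Distribution and expectations of the chain at a fixed time\<close>

locale bd_chain =
  fixes M :: "'a measure" and X :: "nat \<Rightarrow> 'a \<Rightarrow> nat" and r l :: "nat \<Rightarrow> real" and k :: nat
  assumes k: "k \<ge> 1"
    and rl: "\<And>n. n \<ge> 1 \<Longrightarrow> r n + l n = 1"
    and r: "\<And>n. n \<ge> 1 \<Longrightarrow> 0 < r n"
    and l: "\<And>n. n \<ge> 1 \<Longrightarrow> 0 < l n"
    and chain: "birth_death_chain M r l X"
    and start: "AE \<omega> in M. X 0 \<omega> = k"
begin

sublocale prob_space M
  using chain by (simp add: birth_death_chain_def markov_chain_def)

lemma measurable_X [measurable]: "X m \<in> M \<rightarrow>\<^sub>M count_space UNIV"
  using chain by (simp add: birth_death_chain_def markov_chain_def)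

definition P :: "nat \<Rightarrow> nat \<Rightarrow> real" where
  "P m n = prob {\<omega> \<in> space M. X m \<omega> = n}"

lemma P_nonneg: "0 \<le> P m n"
  by (simp add: P_def)

lemma trans_nonneg: "0 \<le> birth_death_trans r l i j"
  using less_imp_le[OF r[of i]] less_imp_le[OF l[of i]] by (simp add: birth_death_trans_def)

text \<open>Total probability over the state at time m. The integral over counting measure avoids
  questions of summability; finite support is derived from this formula afterwards.\<close>

lemma nn_integral_P_Suc:
  "ennreal (P (Suc m) j) = (\<integral>\<^sup>+i. ennreal (P m i * birth_death_trans r l i j) \<partial>count_space UNIV)"
proof -
  have "ennreal (P (Suc m) j) = emeasure M (\<Union>i. {\<omega> \<in> space M. X m \<omega> = i \<and> X (Suc m) \<omega> = j})"
    unfolding P_def emeasure_eq_measure[symmetric] by (rule arg_cong[where f = "emeasure M"]) auto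
  also have "\<dots> = (\<integral>\<^sup>+i. emeasure M {\<omega> \<in> space M. X m \<omega> = i \<and> X (Suc m) \<omega> = j} \<partial>count_space UNIV)"
    by (rule emeasure_UN_countable) (auto simp: disjoint_family_on_def)
  also have "\<dots> = (\<integral>\<^sup>+i. ennreal (P m i * birth_death_trans r l i j) \<partial>count_space UNIV)"
    using chain
    by (intro nn_integral_cong)
      (simp add: emeasure_eq_measure markov_chain_joint birth_death_chain_def P_def)
  finally show ?thesis .
qed

text \<open>A step moves right by at most one. This turns all expectations below into finite
  sums.\<close>

lemma P_support: "n > k + m \<Longrightarrow> P m n = 0"
proof (induction m arbitrary: n)
  case 0
  have "AE \<omega> in M. \<not> X 0 \<omega> = n" using start by eventually_elim (use 0 in auto)
  then show ?case unfolding P_def by (subst prob_eq_0) auto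
next
  case (Suc m)
  have "P m i * birth_death_trans r l i n = 0" for i
    using Suc by (cases "i > k + m") (auto simp: birth_death_trans_def)
  then have "ennreal (P (Suc m) n) = 0"
    unfolding nn_integral_P_Suc by (simp only: ennreal_0 nn_integral_const) simp
  then show ?case using P_nonneg by (simp add: ennreal_eq_0_iff antisym)
qed

text \<open>The cutoff N is left free so that the range can be enlarged to contain a prescribed
  state, as in \<open>P_Suc_ge\<close>.\<close>

lemma P_Suc:
  assumes "N \<ge> k + m"
  shows "P (Suc m) j = (\<Sum>i\<le>N. P m i * birth_death_trans r l i j)"
proof -
  have "ennreal (P (Suc m) j) = (\<Sum>i\<le>N. ennreal (P m i * birth_death_trans r l i j))"
    unfolding nn_integral_P_Suc
    by (rule nn_integral_count_space') (use assms P_support in auto)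
  also have "\<dots> = ennreal (\<Sum>i\<le>N. P m i * birth_death_trans r l i j)"
    by (rule sum_ennreal) (simp add: P_nonneg trans_nonneg)
  finally show ?thesis
    by (simp add: P_nonneg trans_nonneg sum_nonneg)
qed

lemma AE_X_le: "AE \<omega> in M. X m \<omega> \<le> k + m"
proof -
  have "AE \<omega> in M. \<forall>n. n > k + m \<longrightarrow> X m \<omega> \<noteq> n"
    unfolding AE_all_countable
  proof
    fix n
    show "AE \<omega> in M. n > k + m \<longrightarrow> X m \<omega> \<noteq> n"
    proof (cases "n > k + m")
      case True
      then have "AE \<omega> in M. \<not> X m \<omega> = n"
        using P_support[OF True] unfolding P_def by (subst (asm) prob_eq_0) auto
      then show ?thesis by simp
    qed simp
  qed
  then show ?thesis by eventually_elim (metis not_le)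
qed

lemma expectation_eq_sum:
  fixes g :: "nat \<Rightarrow> real"
  assumes "N \<ge> k + m"
  shows "expectation (\<lambda>\<omega>. g (X m \<omega>)) = (\<Sum>i\<le>N. P m i * g i)"
proof -
  \<comment> \<open>Almost surely \<open>g (X m)\<close> is a finite combination of indicators, so
    no growth condition on g is imposed.\<close>
  have "expectation (\<lambda>\<omega>. g (X m \<omega>)) =
      expectation (\<lambda>\<omega>. \<Sum>i\<le>N. indicator {\<omega> \<in> space M. X m \<omega> = i} \<omega> * g i)"
  proof (rule integral_cong_AE)
    show "AE \<omega> in M. g (X m \<omega>) = (\<Sum>i\<le>N. indicator {\<omega> \<in> space M. X m \<omega> = i} \<omega> * g i)"
      using AE_X_le[of m] AE_space
    proof eventually_elim
      case (elim \<omega>)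
      have "(\<Sum>i\<le>N. indicator {\<omega> \<in> space M. X m \<omega> = i} \<omega> * g i) =
          (\<Sum>i\<le>N. if X m \<omega> = i then g i else 0)"
        using elim by (intro sum.cong) (auto simp: indicator_def)
      also have "\<dots> = g (X m \<omega>)" using elim assms by simp
      finally show ?case by simp
    qed
  qed measurable
  also have "\<dots> = (\<Sum>i\<le>N. P m i * g i)"
    by (subst Bochner_Integration.integral_sum)
      (auto simp: P_def less_top[symmetric] intro!: integrable_mult_left integrable_real_indicator sum.cong)
  finally show ?thesis .
qed

section \<open>The scale sequence as a martingale\<close>

lemma sum_P_x: "(\<Sum>i\<le>k + m. P m i * bd_x r l i) = bd_x r l k"
proof (induction m)
  case 0
  have "expectation (\<lambda>\<omega>. bd_x r l (X 0 \<omega>)) = expectation (\<lambda>\<omega>. bd_x r l k)"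
    by (rule integral_cong_AE) (use start in auto)
  then show ?case by (simp add: expectation_eq_sum[symmetric] prob_space)
next
  case (Suc m)
  have harmonic: "(\<Sum>j\<le>k + Suc m. birth_death_trans r l i j * bd_x r l j) = bd_x r l i"
    if i: "i \<le> k + m" for i
  proof (cases i)
    case 0
    then have "(\<Sum>j\<le>k + Suc m. birth_death_trans r l i j * bd_x r l j) = (\<Sum>j\<le>k + Suc m. 0)"
      by (intro sum.cong) (auto simp: birth_death_trans_def)
    then show ?thesis using 0 by simp
  next
    case (Suc n)
    have "(\<Sum>j\<le>k + Suc m. birth_death_trans r l i j * bd_x r l j) =
        (\<Sum>j\<in>{n, Suc (Suc n)}. birth_death_trans r l i j * bd_x r l j)"
      using i Suc by (intro sum.mono_neutral_right) (auto simp: birth_death_trans_def)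
    \<comment> \<open>With i = n + 1, the increments of \<open>bd_x\<close> to the right and left of
      i are t_i and t_n, and r_i t_i = l_i t_n, so the mean displacement is 0.\<close>
    also have "\<dots> = (l i + r i) * bd_x r l i"
      using r[of i] Suc by (simp add: birth_death_trans_def bd_t_Suc algebra_simps)
    finally show ?thesis using rl[of i] Suc by (simp add: add.commute)
  qed
  have "(\<Sum>j\<le>k + Suc m. P (Suc m) j * bd_x r l j) =
      (\<Sum>j\<le>k + Suc m. \<Sum>i\<le>k + m. P m i * (birth_death_trans r l i j * bd_x r l j))"
    by (simp only: P_Suc[OF order_refl] sum_distrib_right mult.assoc)
  also have "\<dots> = (\<Sum>i\<le>k + m. P m i * (\<Sum>j\<le>k + Suc m. birth_death_trans r l i j * bd_x r l j))"
    by (subst sum.swap) (simp only: sum_distrib_left)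
  also have "\<dots> = (\<Sum>i\<le>k + m. P m i * bd_x r l i)"
    by (intro sum.cong refl) (simp only: harmonic atMost_iff)
  finally show ?case using Suc by simp
qed

lemma expectation_minus_x:
  "expectation (\<lambda>\<omega>. real (X m \<omega>)) - c * bd_x r l k =
   (\<Sum>i\<le>k + m. P m i * (real i - c * bd_x r l i))"
proof -
  have "(\<Sum>i\<le>k + m. P m i * (real i - c * bd_x r l i)) =
      (\<Sum>i\<le>k + m. P m i * real i) - c * (\<Sum>i\<le>k + m. P m i * bd_x r l i)"
    by (simp add: sum_subtractf sum_distrib_left algebra_simps)
  then show ?thesis by (simp add: sum_P_x expectation_eq_sum[OF order_refl])
qed

section \<open>Loss of mass from the positive states\<close>

lemma P_Suc_0: "P (Suc m) 0 = P m 0 + l 1 * P m 1"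
proof -
  have "P (Suc m) 0 = (\<Sum>i\<le>k + m. P m i * birth_death_trans r l i 0)"
    by (rule P_Suc) simp
  \<comment> \<open>State 0 is entered only from 0 and 1; k \<ge> 1 keeps index 1 inside the range
    even at m = 0.\<close>
  also have "\<dots> = (\<Sum>i\<in>{0, 1}. P m i * birth_death_trans r l i 0)"
    using k by (intro sum.mono_neutral_right) (auto simp: birth_death_trans_def)
  finally show ?thesis by (simp add: birth_death_trans_def)
qed

lemma P_Suc_ge: "P m (Suc n) * l (Suc n) \<le> P (Suc m) n"
proof -
  have "P m (Suc n) * birth_death_trans r l (Suc n) n \<le>
      (\<Sum>i\<le>k + m + Suc n. P m i * birth_death_trans r l i n)"
    by (rule member_le_sum) (auto simp: P_nonneg trans_nonneg)
  also have "\<dots> = P (Suc m) n" by (rule P_Suc[symmetric]) simp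
  finally show ?thesis by (simp add: birth_death_trans_def)
qed

text \<open>The increments of the convergent sequence \<open>P m 0\<close> are
  \<open>l 1 * P m 1\<close>, which settles n = 1. Since a fixed fraction \<open>l (Suc n)\<close>
  of the mass at n + 1 arrives at n one step later, the decay passes from n to n + 1.\<close>

lemma P_tendsto_0: "n \<ge> 1 \<Longrightarrow> (\<lambda>m. P m n) \<longlonglongrightarrow> 0"
proof (induction n rule: dec_induct)
  case base
  have "incseq (\<lambda>m. P m 0)"
    using P_nonneg l[of 1] by (intro incseq_SucI) (simp add: P_Suc_0)
  moreover have "P m 0 \<le> 1" for m by (simp add: P_def)
  ultimately obtain z where z: "(\<lambda>m. P m 0) \<longlonglongrightarrow> z"
    using incseq_convergent[of "\<lambda>m. P m 0" 1] by blast
  have "(\<lambda>m. (P (Suc m) 0 - P m 0) / l 1) \<longlonglongrightarrow> (z - z) / l 1"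
    using l[of 1] by (intro tendsto_intros LIMSEQ_Suc z) auto
  then show ?case using l[of 1] by (simp add: P_Suc_0)
next
  case (step n)
  have "(\<lambda>m. P (Suc m) n / l (Suc n)) \<longlonglongrightarrow> 0 / l (Suc n)"
    using l[of "Suc n"] by (intro tendsto_intros LIMSEQ_Suc step) auto
  then have "(\<lambda>m. P (Suc m) n / l (Suc n)) \<longlonglongrightarrow> 0" by simp
  then show ?case
    by (rule tendsto_sandwich[OF _ _ tendsto_const, rotated -1])
      (use P_Suc_ge[of _ n] l[of "Suc n"] P_nonneg in \<open>auto simp: field_simps\<close>)
qed

section \<open>Asymptotics of the mean\<close>

lemma eventually_sum_P_gt:
  assumes "g 0 = 0" and "\<forall>\<^sub>F n in sequentially. 0 \<le> g n" and "e > 0"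
  shows "\<forall>\<^sub>F m in sequentially. - e < (\<Sum>i\<le>k + m. P m i * g i)"
proof -
  from assms(2) obtain N where N: "\<And>n. n \<ge> N \<Longrightarrow> 0 \<le> g n"
    by (auto simp: eventually_sequentially)
  \<comment> \<open>State 0 retains mass in the limit, possibly all of it, and is harmless only
    because g vanishes there.\<close>
  have "(\<lambda>m. \<Sum>i<N. P m i * g i) \<longlonglongrightarrow> (\<Sum>i<N. 0)"
  proof (rule tendsto_sum)
    fix i
    show "(\<lambda>m. P m i * g i) \<longlonglongrightarrow> 0"
      using assms(1) by (cases "i = 0") (auto intro!: tendsto_mult_left_zero P_tendsto_0)
  qed
  then have "(\<lambda>m. \<Sum>i<N. P m i * g i) \<longlonglongrightarrow> 0" by simp
  from order_tendstoD(1)[OF this, of "- e"] assms(3)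
  have "\<forall>\<^sub>F m in sequentially. - e < (\<Sum>i<N. P m i * g i)" by simp
  then show ?thesis
    using eventually_ge_at_top[of N]
  proof eventually_elim
    case (elim m)
    have "(\<Sum>i<N. P m i * g i) \<le> (\<Sum>i\<le>k + m. P m i * g i)"
      using elim(2) N P_nonneg by (intro sum_mono2) auto
    with elim show ?case by linarith
  qed
qed

text \<open>Dividing by x_k > 0 and arguing in the order topology of \<open>ereal\<close> treats L =
  0, finite L and L = \<infinity> uniformly; for L = \<infinity> the upper half is vacuous.\<close>

lemma tendsto_expectation:
  assumes L: "(\<lambda>n. ereal (1 / bd_t r l n)) \<longlonglongrightarrow> L"
  shows "(\<lambda>m. ereal (expectation (\<lambda>\<omega>. real (X m \<omega>)))) \<longlonglongrightarrow> ereal (bd_x r l k) * L"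
proof -
  let ?E = "\<lambda>m. expectation (\<lambda>\<omega>. real (X m \<omega>))" and ?x = "bd_x r l" and ?t = "bd_t r l"
  have t: "0 < ?t n" for n by (rule bd_t_pos[of r l, OF r l])
  have xk: "0 < ?x k"
    using strict_monoD[OF bd_x_strict_mono[of r l, OF r l], of 0 k] k by simp
  have g: "real n - c * ?x n = (\<Sum>i<n. 1 - c * ?t i)" for n c
    by (simp add: bd_x_eq_sum sum_subtractf sum_distrib_left)
  have L0: "0 \<le> L"
    by (rule tendsto_lowerbound[OF L]) (auto intro!: always_eventually simp: less_imp_le[OF t])
  have "(\<lambda>m. ereal (?E m / ?x k)) \<longlonglongrightarrow> L"
  proof (rule order_tendstoI)
    fix a assume "a < L"
    then obtain c where c: "a < ereal c" "ereal c < L" using ereal_dense2 by blast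
    \<comment> \<open>Two margins around c: the gap from c to c2 keeps the summands 1 - c t_i away
      from 0, and the gap from c1 to c absorbs the error allowed by
      \<open>eventually_sum_P_gt\<close>.\<close>
    from c(1) obtain c1 where c1: "a < ereal c1" "ereal c1 < ereal c" using ereal_dense2 by blast
    from c(2) obtain c2 where c2: "ereal c < ereal c2" "ereal c2 < L" using ereal_dense2 by blast
    have "\<forall>\<^sub>F n in sequentially. 0 \<le> real n - c * ?x n"
      unfolding g
    proof (rule eventually_sum_nonneg)
      \<comment> \<open>For c \<le> 0 every summand is at least 1. Otherwise c2 > 0, and 1 / t_i >
        c2 gives c t_i \<le> c / c2 < 1.\<close>
      let ?d = "if c \<le> 0 then 1 else 1 - c / c2"
      show "0 < ?d" using c2 by simp
      show "\<forall>\<^sub>F i in sequentially. ?d \<le> 1 - c * ?t i"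
        using order_tendstoD(1)[OF L c2(2)]
      proof eventually_elim
        case (elim i)
        show ?case
        proof (cases "c \<le> 0")
          case True
          then show ?thesis using t[of i] by (simp add: mult_nonpos_nonneg)
        next
          case False
          have "?t i \<le> 1 / c2" using elim t[of i] False c2 by (simp add: field_simps)
          from mult_left_mono[OF this, of c] show ?thesis using False by simp
        qed
      qed
    qed
    then have "\<forall>\<^sub>F m in sequentially. - ((c - c1) * ?x k) < (\<Sum>i\<le>k + m. P m i * (real i - c * ?x i))"
      by (intro eventually_sum_P_gt) (use c1 xk in auto)
    then show "\<forall>\<^sub>F m in sequentially. a < ereal (?E m / ?x k)"
    proof eventually_elim
      case (elim m)
      then have "c1 * ?x k < ?E m"
        unfolding expectation_minus_x[symmetric] by (simp add: algebra_simps)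
      then have "c1 < ?E m / ?x k" using xk by (simp add: field_simps)
      then have "ereal c1 < ereal (?E m / ?x k)" by simp
      with c1(1) show ?case by (rule less_trans)
    qed
  next
    fix a assume "L < a"
    then obtain c where c: "L < ereal c" "ereal c < a" using ereal_dense2 by blast
    from c(2) obtain c1 where c1: "ereal c < ereal c1" "ereal c1 < a" using ereal_dense2 by blast
    from c(1) obtain c2 where c2: "L < ereal c2" "ereal c2 < ereal c" using ereal_dense2 by blast
    \<comment> \<open>Here L \<ge> 0 forces c2 > 0, so no case distinction on the sign of c
      arises.\<close>
    have "0 < ereal c2" using L0 c2(1) by (rule le_less_trans)
    then have c20: "0 < c2" by simp
    have "\<forall>\<^sub>F n in sequentially. 0 \<le> (\<Sum>i<n. c * ?t i - 1)"
    proof (rule eventually_sum_nonneg)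
      show "0 < c / c2 - 1" using c2 c20 by simp
      show "\<forall>\<^sub>F i in sequentially. c / c2 - 1 \<le> c * ?t i - 1"
        using order_tendstoD(2)[OF L c2(1)]
      proof eventually_elim
        case (elim i)
        have "1 / c2 \<le> ?t i" using elim t[of i] c20 by (simp add: field_simps)
        from mult_left_mono[OF this, of c] show ?case using c20 c2 by simp
      qed
    qed
    also have "(\<lambda>n. \<Sum>i<n. c * ?t i - 1) = (\<lambda>n. - (real n - c * ?x n))"
      unfolding g by (simp flip: sum_negf)
    finally have "\<forall>\<^sub>F m in sequentially.
        - ((c1 - c) * ?x k) < (\<Sum>i\<le>k + m. P m i * - (real i - c * ?x i))"
      by (intro eventually_sum_P_gt) (use c1 xk in auto)
    then show "\<forall>\<^sub>F m in sequentially. ereal (?E m / ?x k) < a"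
    proof eventually_elim
      case (elim m)
      then have "?E m < c1 * ?x k"
        unfolding mult_minus_right sum_negf expectation_minus_x[symmetric]
        by (simp add: algebra_simps)
      then have "?E m / ?x k < c1" using xk by (simp add: field_simps)
      then have "ereal (?E m / ?x k) < ereal c1" by simp
      from this c1(2) show ?case by (rule less_trans)
    qed
  qed
  then have "(\<lambda>m. ereal (?x k) * ereal (?E m / ?x k)) \<longlonglongrightarrow> ereal (?x k) * L"
    by (rule tendsto_cmult_ereal[rotated]) simp
  then show ?thesis using xk by simp
qed

end

theorem theorem2:
  fixes M :: "'a measure"
    and X :: "nat \<Rightarrow> 'a \<Rightarrow> nat"
    and r l :: "nat \<Rightarrow> real"
    and \<phi> :: "real \<Rightarrow> real"
    and k :: nat
    and L :: ereal
  assumes "k \<ge> 1"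
    and "\<And>n. n \<ge> 1 \<Longrightarrow> r n + l n = 1"
    and "\<And>n. n \<ge> 1 \<Longrightarrow> 0 < r n \<and> r n < 1"
    and "birth_death_chain M r l X"
    and "AE \<omega> in M. X 0 \<omega> = k"
    and "bd_phi r l \<phi>"
    and "(\<lambda>n. ereal (bd_slope r l \<phi> n)) \<longlonglongrightarrow> L"
  shows "(\<lambda>m. ereal (integral\<^sup>L M (\<lambda>\<omega>. real (X m \<omega>))))
           \<longlonglongrightarrow> ereal (bd_x r l k) * L"
proof -
  have rpos: "0 < r n" and lpos: "0 < l n" if "n \<ge> 1" for n
    using assms(2,3)[OF that] by auto
  interpret bd_chain M X r l k
    by unfold_locales (use assms rpos lpos in auto)
  \<comment> \<open>The slope with index n + 1 is 1 / t_n; the shift also discards index 0, to which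
    no interval corresponds.\<close>
  have "(\<lambda>n. ereal (bd_slope r l \<phi> (Suc n))) \<longlonglongrightarrow> L"
    using assms(7) by (rule LIMSEQ_Suc)
  then have "(\<lambda>n. ereal (1 / bd_t r l n)) \<longlonglongrightarrow> L"
    by (simp add: bd_slope_eq(1)[OF rpos lpos assms(6)])
  then show ?thesis by (rule tendsto_expectation)
qed

end
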